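(* Let $G$ be a countable group. If $X$ is a $G$-subshift with the finite extension property, then $X$ is a strongly irreducible $G$-subshift of finite type.
   Context: Let $G$ be a countable group with identity $e$. For a finite nonempty set (alphabet) $\mathcal{A}$ with the discrete topology, $\mathcal{A}^G$ carries the product topology, and $G$ acts by the shift $(\sigma^g x)(h) = x(g^{-1}h)$. A $G$-subshift is a closed set $X \subset \mathcal{A}^G$ with $\sigma^g(X)=X$ for all $g\in G$. Patterns: for $S\subset G$ (possibly infinite or empty), called a shape, a pattern of shape $S$ is an element $w\in\mathcal{A}^S$; for $S'\subset S$, $w(S')$ denotes the restriction of $w$ to $S'$. For $g\in G$ and $w\in \mathcal{A}^S$, $g\cdot w\in\mathcal{A}^{gS}$ is given by $(g\cdot w)(gs)=w(s)$ for $s \in S$. Let $\mathcal{L}_S(X)=\{x(S):x\in X\}$. If $u\in\mathcal{A}^E$ and $v\in\mathcal{A}^F$ agree on $E\cap F$, then $u\cup v\in\mathcal{A}^{E\cup F}$ denotes their common extension. For finite $K\subset G$ and $\mathcal{F}\subset\mathcal{A}^K$, let $X_{\mathcal{F}}=\{x\in\mathcal{A}^G : \forall g\in G,\ (\sigma^g x)(K)\notin\mathcal{F}\}$. A subshift $X\subset\mathcal{A}^G$ is a subshift of finite type (SFT) if $X=X_{\mathcal{F}}$ for some finite $K\subset G$ and some $\mathcal{F}\subset\mathcal{A}^K$. A subshift $X$ is strongly irreducible if there exists a finite set $K\subset G$ such that for all $E,F\subset G$ and all $u\in\mathcal{L}_E(X)$, $v\in\mathcal{L}_F(X)$, if $EK\cap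 F=\varnothing$ then $u\cup v\in\mathcal{L}_{E\cup F}(X)$. Finite extension property (FEP): a $G$-subshift $X$ with alphabet $\mathcal{A}$ has the FEP if there exist a finite set $K\subset G$ containing $e$ and a collection $\mathcal{F}\subset\mathcal{A}^K$ such that $X=X_{\mathcal{F}}$ and, for every $S\subset G$ and every $w\in\mathcal{A}^S$, if there exists $w'\in\mathcal{A}^{SK}$ with $w'(S)=w$ and $g^{-1}\cdot w'(gK)\notin\mathcal{F}$ for all $g\in S$, then there exists $x\in X$ with $x(S)=w$. *)

theory Defs
  imports "HOL-Algebra.Coset" "HOL-Analysis.Function_Topology"
begin

text \<open>
  A pattern of shape \<open>S\<close> over the alphabet \<open>A\<close> is an extensional function in \<open>S \<rightarrow>\<^sub>E A\<close> (it takes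
  the value \<open>undefined\<close> off \<open>S\<close>), so that equality of patterns of the same shape is equality of
  functions and the restriction of \<open>w\<close> to \<open>S'\<close> is \<open>restrict w S'\<close>. Configurations are the patterns
  of shape \<open>carrier G\<close>.
\<close>

definition patterns :: "'a set \<Rightarrow> 'g set \<Rightarrow> ('g \<Rightarrow> 'a) set" where
  "patterns A S = (S \<rightarrow>\<^sub>E A)"

definition shift :: "('g, 'm) monoid_scheme \<Rightarrow> 'g \<Rightarrow> ('g \<Rightarrow> 'a) \<Rightarrow> 'g \<Rightarrow> 'a" where
  "shift G g x = (\<lambda>h\<in>carrier G. x (inv\<^bsub>G\<^esub> g \<otimes>\<^bsub>G\<^esub> h))"

text \<open>
  \<open>translate G g S w\<close> is the pattern \<open>g \<cdot> w\<close> of shape \<open>gS\<close>, for \<open>w\<close> of shape \<open>S\<close>. The shape has to be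
  passed explicitly.
\<close>

definition translate ::
  "('g, 'm) monoid_scheme \<Rightarrow> 'g \<Rightarrow> 'g set \<Rightarrow> ('g \<Rightarrow> 'a) \<Rightarrow> 'g \<Rightarrow> 'a" where
  "translate G g S w = (\<lambda>h\<in>g <#\<^bsub>G\<^esub> S. w (inv\<^bsub>G\<^esub> g \<otimes>\<^bsub>G\<^esub> h))"

definition subshift :: "('g, 'm) monoid_scheme \<Rightarrow> 'a set \<Rightarrow> ('g \<Rightarrow> 'a) set \<Rightarrow> bool" where
  "subshift G A X \<longleftrightarrow>
     closedin (product_topology (\<lambda>_. discrete_topology A) (carrier G)) X \<and>
     (\<forall>g\<in>carrier G. shift G g ` X = X)"

definition language :: "'g set \<Rightarrow> ('g \<Rightarrow> 'a) set \<Rightarrow> ('g \<Rightarrow> 'a) set" where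
  "language S X = (\<lambda>x. restrict x S) ` X"

definition agree_on :: "'g set \<Rightarrow> ('g \<Rightarrow> 'a) \<Rightarrow> ('g \<Rightarrow> 'a) \<Rightarrow> bool" where
  "agree_on S u v \<longleftrightarrow> (\<forall>g\<in>S. u g = v g)"

text \<open>The common extension of \<open>u\<close> of shape \<open>E\<close> and \<open>v\<close> of shape \<open>F\<close>; only meaningful if they agree
  on \<open>E \<inter> F\<close>.\<close>

definition pattern_union ::
  "'g set \<Rightarrow> 'g set \<Rightarrow> ('g \<Rightarrow> 'a) \<Rightarrow> ('g \<Rightarrow> 'a) \<Rightarrow> 'g \<Rightarrow> 'a" where
  "pattern_union E F u v = (\<lambda>g\<in>E \<union> F. if g \<in> E then u g else v g)"

definition avoiding ::
  "('g, 'm) monoid_scheme \<Rightarrow> 'a set \<Rightarrow> 'g set \<Rightarrow> ('g \<Rightarrow> 'a) set \<Rightarrow> ('g \<Rightarrow> 'a) set" where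
  "avoiding G A K \<F> =
     {x \<in> patterns A (carrier G). \<forall>g\<in>carrier G. restrict (shift G g x) K \<notin> \<F>}"

definition subshift_of_finite_type ::
  "('g, 'm) monoid_scheme \<Rightarrow> 'a set \<Rightarrow> ('g \<Rightarrow> 'a) set \<Rightarrow> bool" where
  "subshift_of_finite_type G A X \<longleftrightarrow>
     subshift G A X \<and>
     (\<exists>K \<F>. finite K \<and> K \<subseteq> carrier G \<and> \<F> \<subseteq> patterns A K \<and> X = avoiding G A K \<F>)"

text \<open>
  As \<open>K\<close> need not contain the identity, \<open>EK \<inter> F = {}\<close> does not by itself make \<open>E\<close> and \<open>F\<close> disjoint.
  Asserting that \<open>u \<union> v\<close> lies in the language includes asserting that \<open>u \<union> v\<close> is defined.
\<close>

definition strongly_irreducible ::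
  "('g, 'm) monoid_scheme \<Rightarrow> 'a set \<Rightarrow> ('g \<Rightarrow> 'a) set \<Rightarrow> bool" where
  "strongly_irreducible G A X \<longleftrightarrow>
     subshift G A X \<and>
     (\<exists>K. finite K \<and> K \<subseteq> carrier G \<and>
       (\<forall>E F. E \<subseteq> carrier G \<longrightarrow> F \<subseteq> carrier G \<longrightarrow>
         (\<forall>u\<in>language E X. \<forall>v\<in>language F X.
           (E <#>\<^bsub>G\<^esub> K) \<inter> F = {} \<longrightarrow>
             agree_on (E \<inter> F) u v \<and> pattern_union E F u v \<in> language (E \<union> F) X)))"

definition finite_extension_property ::
  "('g, 'm) monoid_scheme \<Rightarrow> 'a set \<Rightarrow> ('g \<Rightarrow> 'a) set \<Rightarrow> bool" where
  "finite_extension_property G A X \<longleftrightarrow>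
     subshift G A X \<and>
     (\<exists>K \<F>. finite K \<and> K \<subseteq> carrier G \<and> \<one>\<^bsub>G\<^esub> \<in> K \<and> \<F> \<subseteq> patterns A K \<and>
       X = avoiding G A K \<F> \<and>
       (\<forall>S w. S \<subseteq> carrier G \<longrightarrow> w \<in> patterns A S \<longrightarrow>
         (\<exists>w'\<in>patterns A (S <#>\<^bsub>G\<^esub> K).
            restrict w' S = w \<and>
            (\<forall>g\<in>S. translate G (inv\<^bsub>G\<^esub> g) (g <#\<^bsub>G\<^esub> K) (restrict w' (g <#\<^bsub>G\<^esub> K)) \<notin> \<F>)) \<longrightarrow>
         (\<exists>x\<in>X. restrict x S = w)))"

end

theory Submission
  imports Defs
begin

text \<open>
  Finite type is part of the finite extension property. For strong irreducibility, let \<open>K\<close> be the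
  window of the finite extension property. The set \<open>K K\<^sup>-\<^sup>1\<close> serves as the gap: if \<open>E K K\<^sup>-\<^sup>1\<close> misses
  \<open>F\<close>, then the neighbourhoods \<open>E K\<close> and \<open>F K\<close> are disjoint. So for \<open>x\<close>, \<open>y\<close> in \<open>X\<close> one can
  glue \<open>x\<close> on \<open>E K\<close> to \<open>y\<close> on \<open>F K\<close>, and no window \<open>g K\<close> with \<open>g\<close> in \<open>E\<close> or \<open>F\<close> straddles the two
  pieces: each such window sees only \<open>x\<close> or only \<open>y\<close>, hence no forbidden pattern. The finite
  extension property then extends the restriction of the glued pattern to \<open>E \<union> F\<close> to a point
  of \<open>X\<close>.
\<close>

lemma languageI: "\<exists>z\<in>X. restrict z S = w \<Longrightarrow> w \<in> language S X"
  unfolding language_def by blast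

text \<open>
  The two descriptions of a window at \<open>g\<close> coincide: moving the pattern seen on \<open>g K\<close> back to \<open>K\<close>
  is looking through \<open>K\<close> at the shifted configuration. Only the values on \<open>g K\<close> enter, so \<open>z\<close> may
  be any pattern that agrees with \<open>x\<close> there.
\<close>

lemma (in group) translate_window_eq_shift:
  assumes "g \<in> carrier G" and "K \<subseteq> carrier G"
    and agree: "\<And>h. h \<in> g <# K \<Longrightarrow> z h = x h"
  shows "translate G (inv g) (g <# K) (restrict z (g <# K)) = restrict (shift G (inv g) x) K"
proof -
  have "inv g <# (g <# K) = K"
    using assms by (simp add: lcos_m_assoc lcos_mult_one)
  moreover have "g \<otimes> h \<in> g <# K" if "h \<in> K" for h
    using that by (auto simp: l_coset_def)
  ultimately show ?thesis
    using assms by (auto simp: translate_def shift_def fun_eq_iff)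
qed

text \<open>
  A common point \<open>a k = b l\<close> of the two thickenings would give \<open>b = a k l\<^sup>-\<^sup>1\<close>, a point of \<open>F\<close> in
  \<open>E K K\<^sup>-\<^sup>1\<close>.
\<close>

lemma (in group) disjoint_thickenings:
  assumes "E \<subseteq> carrier G" "F \<subseteq> carrier G" "K \<subseteq> carrier G"
    and disj: "(E <#> (K <#> (m_inv G ` K))) \<inter> F = {}"
  shows "(E <#> K) \<inter> (F <#> K) = {}"
proof (rule ccontr)
  assume "(E <#> K) \<inter> (F <#> K) \<noteq> {}"
  then obtain a k b l where *: "a \<in> E" "k \<in> K" "b \<in> F" "l \<in> K" "a \<otimes> k = b \<otimes> l"
    by (auto simp: set_mult_def)
  then have c: "a \<in> carrier G" "k \<in> carrier G" "b \<in> carrier G" "l \<in> carrier G"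
    using assms by auto
  have "b = a \<otimes> (k \<otimes> inv l)"
    using c *(5) by (metis inv_closed inv_solve_right m_assoc m_closed)
  moreover have "a \<otimes> (k \<otimes> inv l) \<in> E <#> (K <#> (m_inv G ` K))"
    using * by (auto simp: set_mult_def)
  ultimately show False
    using disj * by auto
qed

theorem proposition3p2:
  fixes G :: "('g, 'm) monoid_scheme" and A :: "'a set" and X :: "('g \<Rightarrow> 'a) set"
  assumes "group G" and "countable (carrier G)"
    and "finite A" and "A \<noteq> {}"
    and "subshift G A X"
    and "finite_extension_property G A X"
  shows "strongly_irreducible G A X \<and> subshift_of_finite_type G A X"
proof -
  interpret group G by fact
  obtain K \<F> where K: "finite K" "K \<subseteq> carrier G" "\<one>\<^bsub>G\<^esub> \<in> K" and \<F>: "\<F> \<subseteq> patterns A K"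
    and X: "X = avoiding G A K \<F>"
    and extend: "\<And>S w w'. \<lbrakk>S \<subseteq> carrier G; w \<in> patterns A S; w' \<in> patterns A (S <#>\<^bsub>G\<^esub> K);
        restrict w' S = w;
        \<forall>g\<in>S. translate G (inv\<^bsub>G\<^esub> g) (g <#\<^bsub>G\<^esub> K) (restrict w' (g <#\<^bsub>G\<^esub> K)) \<notin> \<F>\<rbrakk>
        \<Longrightarrow> \<exists>x\<in>X. restrict x S = w"
    using assms(6) unfolding finite_extension_property_def by metis
  have XA: "x h \<in> A" if "x \<in> X" "h \<in> carrier G" for x h
    using that by (auto simp: X avoiding_def patterns_def)
  have allowed: "restrict (shift G g x) K \<notin> \<F>" if "x \<in> X" "g \<in> carrier G" for x g
    using that by (auto simp: X avoiding_def)
  define L where "L = K <#>\<^bsub>G\<^esub> (m_inv G ` K)"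
  have L: "finite L" "L \<subseteq> carrier G"
    using K by (auto simp: L_def set_mult_def)
  have one_L: "\<one>\<^bsub>G\<^esub> \<in> L"
    using K(3) by (force simp: L_def set_mult_def)
  have glue: "agree_on (E \<inter> F) u v \<and> pattern_union E F u v \<in> language (E \<union> F) X"
    if EF: "E \<subseteq> carrier G" "F \<subseteq> carrier G"
      and uv: "u \<in> language E X" "v \<in> language F X"
      and gap: "(E <#>\<^bsub>G\<^esub> L) \<inter> F = {}" for E F u v
  proof -
    obtain x y where x: "x \<in> X" "u = restrict x E" and y: "y \<in> X" "v = restrict y F"
      using uv by (auto simp: language_def)
    have subset_mult: "S \<subseteq> S <#>\<^bsub>G\<^esub> T" if "\<one>\<^bsub>G\<^esub> \<in> T" "S \<subseteq> carrier G" for S T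
      using that by (force simp: set_mult_def)
    have "E \<inter> F = {}"
      using gap subset_mult[OF one_L EF(1)] by auto
    have disj: "(E <#>\<^bsub>G\<^esub> K) \<inter> (F <#>\<^bsub>G\<^esub> K) = {}"
      using disjoint_thickenings EF K gap by (simp add: L_def)
    define w' where "w' = (\<lambda>h\<in>(E \<union> F) <#>\<^bsub>G\<^esub> K. if h \<in> E <#>\<^bsub>G\<^esub> K then x h else y h)"
    have mult_Un: "(E \<union> F) <#>\<^bsub>G\<^esub> K = (E <#>\<^bsub>G\<^esub> K) \<union> (F <#>\<^bsub>G\<^esub> K)"
      by (auto simp: set_mult_def)
    have w'_E: "w' h = x h" if "h \<in> E <#>\<^bsub>G\<^esub> K" for h
      using that by (simp add: w'_def mult_Un)
    have w'_F: "w' h = y h" if "h \<in> F <#>\<^bsub>G\<^esub> K" for h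
      using that disj by (auto simp: w'_def mult_Un)
    have window: "g <#\<^bsub>G\<^esub> K \<subseteq> S <#>\<^bsub>G\<^esub> K" if "g \<in> S" for g S
      using that by (auto simp: l_coset_def set_mult_def)
    have "\<exists>z\<in>X. restrict z (E \<union> F) = pattern_union E F u v"
    proof (rule extend)
      show "E \<union> F \<subseteq> carrier G"
        using EF by simp
      show "pattern_union E F u v \<in> patterns A (E \<union> F)"
        using EF x y XA by (auto simp: pattern_union_def patterns_def)
      have "(E \<union> F) <#>\<^bsub>G\<^esub> K \<subseteq> carrier G"
        using EF K by (simp add: set_mult_closed)
      then show "w' \<in> patterns A ((E \<union> F) <#>\<^bsub>G\<^esub> K)"
        using x y XA by (auto simp: w'_def patterns_def)
      show "restrict w' (E \<union> F) = pattern_union E F u v"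
        using w'_E w'_F subset_mult[OF K(3)] EF x y \<open>E \<inter> F = {}\<close>
        by (auto simp: pattern_union_def fun_eq_iff subset_iff)
      show "\<forall>g\<in>E \<union> F. translate G (inv\<^bsub>G\<^esub> g) (g <#\<^bsub>G\<^esub> K) (restrict w' (g <#\<^bsub>G\<^esub> K)) \<notin> \<F>"
      proof
        fix g assume "g \<in> E \<union> F"
        then have g: "g \<in> carrier G"
          using EF by auto
        \<comment> \<open>The piece that the window at \<open>g\<close> sees: \<open>x\<close> if \<open>g \<in> E\<close>, and \<open>y\<close> if \<open>g \<in> F\<close>.\<close>
        obtain z where z: "z \<in> X" "\<And>h. h \<in> g <#\<^bsub>G\<^esub> K \<Longrightarrow> w' h = z h"
          using \<open>g \<in> E \<union> F\<close> w'_E w'_F window x(1) y(1) by (metis UnE subsetD)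
        show "translate G (inv\<^bsub>G\<^esub> g) (g <#\<^bsub>G\<^esub> K) (restrict w' (g <#\<^bsub>G\<^esub> K)) \<notin> \<F>"
          using translate_window_eq_shift[OF g K(2) z(2)] allowed[OF z(1)] g by simp
      qed
    qed
    then have "pattern_union E F u v \<in> language (E \<union> F) X"
      by (rule languageI)
    then show ?thesis
      using \<open>E \<inter> F = {}\<close> by (simp add: agree_on_def)
  qed
  have "strongly_irreducible G A X"
    unfolding strongly_irreducible_def
    by (intro conjI exI[of _ L] allI impI ballI assms(5) L glue[THEN conjunct1] glue[THEN conjunct2])
  moreover have "subshift_of_finite_type G A X"
    unfolding subshift_of_finite_type_def
    by (intro conjI exI[of _ K] exI[of _ \<F>] assms(5) K(1,2) \<F> X)
  ultimately show ?thesis ..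
qed

end
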